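(* Let $n$ be a positive integer and let $G=(U,V,E)$ be a bipartite graph with $U=\{u_1,\dots,u_n\}$, $V=\{v_1,\dots,v_n\}$ and $E\subseteq U\times V$. For every integer $k$ with $n\ge k>\frac{n}{2}$, $$\sum_{1\le i,j\le n}\mathbf{1}\Big\{|\deg(u_i)-\deg(v_j)|\ge k\Big\}\le 2k(n-k).$$
   Context: $\deg(w)$ denotes the degree of vertex $w$ in $G$, and $\mathbf{1}\{\cdot\}$ is the indicator of the event in braces. *)

theory Defs
  imports Complex_Main
begin

text \<open>An edge between \<open>x \<in> U\<close> and \<open>y \<in> V\<close> is encoded as the pair \<open>(x, y)\<close>. Both parts live in one
  vertex type, so their disjointness is required explicitly.\<close>

definition bipartite_graph :: "'a set \<Rightarrow> 'a set \<Rightarrow> ('a \<times> 'a) set \<Rightarrow> bool" where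
  "bipartite_graph U V E \<longleftrightarrow> finite U \<and> finite V \<and> U \<inter> V = {} \<and> E \<subseteq> U \<times> V"

definition deg :: "('a \<times> 'a) set \<Rightarrow> 'a \<Rightarrow> nat" where
  "deg E w = card {e \<in> E. w = fst e \<or> w = snd e}"

end

theory Submission
  imports Defs
begin

text \<open>Put \<open>m = n - k\<close>. The pairs with \<open>deg v - deg u \<ge> k\<close> are covered, for every threshold \<open>a\<close>, by the
  rows \<open>deg u < a\<close> together with the columns \<open>deg v \<ge> a + k\<close>. Averaging over \<open>a\<close> and double counting the
  edges between the vertices \<open>u\<close> of degree at most \<open>m\<close> and the vertices \<open>v\<close> of degree at least \<open>k\<close> shows
  that for some \<open>a\<close> this cover has at most \<open>m\<close> lines. The pairs with \<open>deg u - deg v \<ge> k\<close> are covered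
  likewise. Since \<open>2k > n\<close>, the two kinds of pairs occupy disjoint sets of rows and disjoint sets of
  columns, and optimising the sizes of the two covers yields \<open>2m(n - m)\<close>.\<close>

section \<open>Double counting for the threshold covers\<close>

lemma sum_card_less:
  fixes f :: "'a \<Rightarrow> nat"
  assumes "finite X"
  shows "(\<Sum>a=1..m. card {x\<in>X. f x < a}) = (\<Sum>x\<in>X. m - f x)"
proof -
  have "(\<Sum>a=1..m. card {x\<in>X. f x < a}) = (\<Sum>x\<in>X. card {a\<in>{1..m}. f x < a})"
    using assms by (intro sum_multicount_gen) auto
  also have "\<dots> = (\<Sum>x\<in>X. m - f x)"
  proof (intro sum.cong refl)
    fix x
    have "{a\<in>{1..m}. f x < a} = {f x<..m}"
      by auto
    then show "card {a\<in>{1..m}. f x < a} = m - f x" by simp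
  qed
  finally show ?thesis .
qed

text \<open>Each \<open>y\<close> is counted once per threshold up to \<open>g y - k\<close>; the
  bound \<open>g y <= m + k\<close> guarantees that the range \<open>1..m\<close> contains all of
  these thresholds.\<close>

lemma sum_card_ge:
  fixes g :: "'a \<Rightarrow> nat"
  assumes "finite Y" "\<And>y. y \<in> Y \<Longrightarrow> g y \<le> m + k"
  shows "(\<Sum>a=1..m. card {y\<in>Y. a + k \<le> g y}) = (\<Sum>y\<in>Y. g y - k)"
proof -
  have "(\<Sum>a=1..m. card {y\<in>Y. a + k \<le> g y}) = (\<Sum>y\<in>Y. card {a\<in>{1..m}. a + k \<le> g y})"
    using assms by (intro sum_multicount_gen) auto
  also have "\<dots> = (\<Sum>y\<in>Y. g y - k)"
  proof (intro sum.cong refl)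
    fix y assume "y \<in> Y"
    then have "{a\<in>{1..m}. a + k \<le> g y} = {1..g y - k}"
      using assms(2)[of y] by auto
    then show "card {a\<in>{1..m}. a + k \<le> g y} = g y - k" by simp
  qed
  finally show ?thesis .
qed

text \<open>The related pairs with second component in \<open>Q\<close> are split by their first
  component: those in \<open>P\<close> are recounted row by row, and outside \<open>P\<close> each
  column of \<open>Q\<close> has at most \<open>card X - card P\<close> of them.\<close>

lemma sum_column_degrees_le:
  fixes R :: "'a \<Rightarrow> 'b \<Rightarrow> bool"
  assumes "finite X" "finite Y" "P \<subseteq> X" "Q \<subseteq> Y"
  shows "(\<Sum>y\<in>Q. card {x\<in>X. R x y}) \<le> (\<Sum>x\<in>P. card {y\<in>Y. R x y}) + card Q * (card X - card P)"
proof -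
  have fin: "finite P" "finite Q"
    using assms finite_subset by blast+
  have "card {x\<in>X. R x y} \<le> card {x\<in>P. R x y} + (card X - card P)" for y
  proof -
    have "card {x\<in>X. R x y} \<le> card ({x\<in>P. R x y} \<union> (X - P))"
      using assms fin by (intro card_mono) auto
    also have "\<dots> \<le> card {x\<in>P. R x y} + card (X - P)"
      by (rule card_Un_le)
    finally show ?thesis
      using assms fin by (simp add: card_Diff_subset)
  qed
  then have "(\<Sum>y\<in>Q. card {x\<in>X. R x y}) \<le> (\<Sum>y\<in>Q. card {x\<in>P. R x y} + (card X - card P))"
    by (intro sum_mono)
  also have "\<dots> = (\<Sum>y\<in>Q. card {x\<in>P. R x y}) + card Q * (card X - card P)"
    by (simp add: sum.distrib)
  also have "(\<Sum>y\<in>Q. card {x\<in>P. R x y}) = (\<Sum>x\<in>P. card {y\<in>Q. R x y})"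
    using fin by (intro sum_multicount_gen) auto
  also have "\<dots> \<le> (\<Sum>x\<in>P. card {y\<in>Y. R x y})"
    using assms by (intro sum_mono card_mono) auto
  finally show ?thesis by simp
qed

text \<open>If all covers had more than \<open>m\<close> lines, thresholds \<open>0\<close> and
  \<open>m + 1\<close> would make both \<open>Q\<close> and \<open>P\<close> larger than
  \<open>m\<close>, while averaging over the thresholds \<open>1..m\<close> would force
  \<open>(p - m) * (q - m) <= 0\<close>.\<close>

lemma small_threshold_cover:
  fixes R :: "'a \<Rightarrow> 'b \<Rightarrow> bool"
  assumes fin: "finite X" "finite Y" and X: "card X = m + k"
  shows "\<exists>a. card {x\<in>X. card {y\<in>Y. R x y} < a} + card {y\<in>Y. a + k \<le> card {x\<in>X. R x y}} \<le> m"
proof (rule ccontr)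
  define f where "f x = card {y\<in>Y. R x y}" for x
  define g where "g y = card {x\<in>X. R x y}" for y
  assume "\<not> ?thesis"
  then have large: "m < card {x\<in>X. f x < a} + card {y\<in>Y. a + k \<le> g y}" for a
    by (auto simp: f_def g_def not_le)
  have g_le: "g y \<le> m + k" for y
    unfolding g_def X[symmetric] using fin by (intro card_mono) auto
  define P where "P = {x\<in>X. f x \<le> m}"
  define Q where "Q = {y\<in>Y. k \<le> g y}"
  define p where "p = card P"
  define q where "q = card Q"
  have empty: "{y\<in>Y. Suc m + k \<le> g y} = {}"
    using g_le by (metis (no_types, lifting) Suc_n_not_le_n add_Suc empty_Collect_eq le_trans)
  \<comment> \<open>At threshold \<open>m + 1\<close> no column qualifies, so the cover is
    \<open>P\<close> alone; at threshold \<open>0\<close> no row qualifies and the cover is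
    \<open>Q\<close> alone.\<close>
  have p: "m < p"
    using large[of "Suc m"] unfolding p_def P_def less_Suc_eq_le empty by simp
  from large[of 0] have q: "m < q"
    by (simp add: q_def Q_def)
  have "m * m \<le> (\<Sum>a=1..m. card {x\<in>X. f x < a} + card {y\<in>Y. a + k \<le> g y})"
    using sum_bounded_below[of "{1..m}" m, OF less_imp_le[OF large]] by simp
  also have "\<dots> = (\<Sum>x\<in>X. m - f x) + (\<Sum>y\<in>Y. g y - k)"
    using sum_card_less[OF fin(1)] sum_card_ge[OF fin(2) g_le] by (simp add: sum.distrib)
  also have "(\<Sum>x\<in>X. m - f x) = (\<Sum>x\<in>P. m - f x)"
    using fin by (intro sum.mono_neutral_right) (auto simp: P_def)
  also have "(\<Sum>y\<in>Y. g y - k) = (\<Sum>y\<in>Q. g y - k)"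
    using fin by (intro sum.mono_neutral_right) (auto simp: Q_def)
  \<comment> \<open>On \<open>P\<close> and \<open>Q\<close> the natural subtractions are not
    truncated, so they become integer differences that can be split.\<close>
  finally have "int (m * m) \<le> int ((\<Sum>x\<in>P. m - f x) + (\<Sum>y\<in>Q. g y - k))"
    by (simp only: of_nat_le_iff)
  also have "\<dots> = (\<Sum>x\<in>P. int m - int (f x)) + (\<Sum>y\<in>Q. int (g y) - int k)"
    by (auto simp: P_def Q_def of_nat_diff intro!: arg_cong2[where f = "(+)"] sum.cong)
  also have "\<dots> = int p * m - (\<Sum>x\<in>P. f x) + (\<Sum>y\<in>Q. g y) - int q * k"
    by (simp add: sum_subtractf p_def q_def)
  finally have 1: "int m * m \<le> int p * m - (\<Sum>x\<in>P. f x) + (\<Sum>y\<in>Q. g y) - int q * k"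
    by simp
  have "p \<le> m + k"
    unfolding p_def X[symmetric] using fin by (intro card_mono) (auto simp: P_def)
  have "(\<Sum>y\<in>Q. g y) \<le> (\<Sum>x\<in>P. f x) + q * (m + k - p)"
    using sum_column_degrees_le[OF fin, of P Q R] X
    by (simp add: f_def g_def p_def q_def P_def Q_def)
  then have "int (\<Sum>y\<in>Q. g y) \<le> int ((\<Sum>x\<in>P. f x) + q * (m + k - p))"
    by (simp only: of_nat_le_iff)
  then have "int (\<Sum>y\<in>Q. g y) \<le> (\<Sum>x\<in>P. f x) + int q * (int m + k - p)"
    using \<open>p \<le> m + k\<close> by (simp add: of_nat_diff)
  \<comment> \<open>Substituting the double count cancels the degree sum over \<open>P\<close> and
    the term \<open>q * k\<close>, leaving \<open>m * m <= p * m + q * m - p * q\<close>.\<close>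
  with 1 have "(int p - m) * (int q - m) \<le> 0"
    by (simp add: algebra_simps)
  moreover have "(int p - m) * (int q - m) > 0"
    using p q by simp
  ultimately show False by simp
qed

section \<open>Size of a set of pairs covered by few lines\<close>

text \<open>Inclusion-exclusion: the row strip \<open>H \<times> Q\<close> and the column strip
  \<open>P \<times> C\<close> overlap exactly in \<open>H \<times> C\<close>.\<close>

lemma card_le_of_cover:
  assumes "finite P" "finite Q" "H \<subseteq> P" "C \<subseteq> Q" "B \<subseteq> H \<times> Q \<union> P \<times> C"
  shows "card B + card H * card C \<le> card H * card Q + card P * card C"
proof -
  have fin: "finite H" "finite C"
    using assms finite_subset by blast+
  have "card B \<le> card (H \<times> Q \<union> P \<times> C)"
    using assms fin by (intro card_mono) auto
  moreover have "H \<times> Q \<inter> P \<times> C = H \<times> C"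
    using assms by auto
  then have "card (H \<times> Q) + card (P \<times> C) = card (H \<times> Q \<union> P \<times> C) + card (H \<times> C)"
    using card_Un_Int[of "H \<times> Q" "P \<times> C"] assms fin by simp
  ultimately show ?thesis
    by (simp add: card_cartesian_product)
qed

text \<open>The cover is cut down to the rows and columns that \<open>B\<close> really meets.
  Measuring it inside the projections of \<open>B\<close> matters later, when these are disjoint
  from the projections of the opposite kind of pairs.\<close>

lemma large_degree_difference_cover:
  fixes R :: "'a \<Rightarrow> 'b \<Rightarrow> bool"
  assumes fin: "finite X" "finite Y" and X: "card X = m + k"
  defines "B \<equiv> {(x, y) \<in> X \<times> Y. card {y\<in>Y. R x y} + k \<le> card {x\<in>X. R x y}}"
  obtains h c where "h \<le> card (fst ` B)" "c \<le> card (snd ` B)" "h + c \<le> m"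
    "card B + h * c \<le> h * card (snd ` B) + card (fst ` B) * c"
proof -
  define f where "f x = card {y\<in>Y. R x y}" for x
  define g where "g y = card {x\<in>X. R x y}" for y
  obtain a where a: "card {x\<in>X. f x < a} + card {y\<in>Y. a + k \<le> g y} \<le> m"
    using small_threshold_cover[OF fin X, of R] by (auto simp: f_def g_def)
  have B: "B = {(x, y) \<in> X \<times> Y. f x + k \<le> g y}"
    by (simp add: B_def f_def g_def)
  have finB: "finite B"
    by (rule finite_subset[of _ "X \<times> Y"]) (use fin B in auto)
  define H where "H = fst ` B \<inter> {x\<in>X. f x < a}"
  define C where "C = snd ` B \<inter> {y\<in>Y. a + k \<le> g y}"
  have "card H \<le> card {x\<in>X. f x < a}" "card C \<le> card {y\<in>Y. a + k \<le> g y}"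
    using fin by (auto simp: H_def C_def intro!: card_mono)
  with a have "card H + card C \<le> m" by linarith
  moreover have "card H \<le> card (fst ` B)" "card C \<le> card (snd ` B)"
    using finB by (auto simp: H_def C_def intro!: card_mono)
  moreover have "B \<subseteq> H \<times> snd ` B \<union> fst ` B \<times> C"
  proof
    fix z assume z: "z \<in> B"
    obtain x y where xy: "z = (x, y)" by force
    have "x \<in> fst ` B" "y \<in> snd ` B"
      using z xy by force+
    moreover have "x \<in> X" "y \<in> Y" "f x + k \<le> g y"
      using z xy B by auto
    \<comment> \<open>If \<open>f x >= a\<close>, then \<open>a + k <= f x + k <= g y\<close>, so
      the column of \<open>y\<close> is in the cover.\<close>
    ultimately show "z \<in> H \<times> snd ` B \<union> fst ` B \<times> C"
      unfolding xy H_def C_def by (cases "f x < a") auto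
  qed
  then have "card B + card H * card C \<le> card H * card (snd ` B) + card (fst ` B) * card C"
    using finB by (intro card_le_of_cover) (auto simp: H_def C_def)
  ultimately show ?thesis using that by blast
qed

section \<open>Optimising the sizes of the two covers\<close>

text \<open>With \<open>h' <= h\<close>, the worst case depends on which cover has more columns. If
  \<open>c <= c'\<close>, the bound becomes \<open>n * (h + c') - 2 * h * c'\<close>, which attains
  the claimed value at \<open>h = c' = m\<close>. Otherwise the first cover dominates in both
  directions and \<open>n * (h + c) <= n * m\<close> suffices.\<close>

lemma two_covers_bound_aux:
  fixes n m :: int
  assumes nonneg: "0 \<le> h" "0 \<le> c" "0 \<le> h'" "0 \<le> c'"
    and le: "h \<le> p" "c \<le> q" "h' \<le> s" "c' \<le> t"
    and sums: "h + c \<le> m" "h' + c' \<le> m" "p + s \<le> n" "q + t \<le> n" "2 * m \<le> n"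
    and "h' \<le> h"
  shows "h * q + p * c - h * c + h' * t + s * c' - h' * c' \<le> 2 * m * (n - m)"
proof -
  have "h * q \<le> h * (n - t)"
    using sums nonneg by (intro mult_left_mono) auto
  moreover have "(h - h') * c' \<le> (h - h') * t"
    using le \<open>h' \<le> h\<close> by (intro mult_left_mono) auto
  ultimately have rows: "h * q + h' * t \<le> h * n - (h - h') * c'"
    by (simp add: algebra_simps)
  show ?thesis
  proof (cases "c \<le> c'")
    case True
    have "s * c' \<le> (n - p) * c'"
      using sums nonneg by (intro mult_right_mono) auto
    moreover have "h * (c' - c) \<le> p * (c' - c)"
      using le True by (intro mult_right_mono) auto
    ultimately have "p * c + s * c' \<le> n * c' - h * (c' - c)"
      by (simp add: algebra_simps)
    with rows have "h * q + p * c - h * c + h' * t + s * c' - h' * c' \<le> n * (h + c') - 2 * h * c'"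
      by (simp add: algebra_simps)
    also have "\<dots> \<le> 2 * m * (n - m)"
    proof -
      \<comment> \<open>The sum of these two products is exactly the right-hand side minus the
        left-hand side.\<close>
      have "0 \<le> (m - h) * (n - 2 * c')" "0 \<le> (m - c') * (n - 2 * m)"
        using sums nonneg by (auto intro!: mult_nonneg_nonneg)
      then show ?thesis by (simp add: algebra_simps)
    qed
    finally show ?thesis .
  next
    case False
    have "p * c \<le> (n - s) * c"
      using sums nonneg by (intro mult_right_mono) auto
    moreover have "h' * (c - c') \<le> s * (c - c')"
      using le False by (intro mult_right_mono) auto
    ultimately have "p * c + s * c' \<le> n * c - h' * (c - c')"
      by (simp add: algebra_simps)
    moreover have "0 \<le> (h - h') * c'" "0 \<le> h' * (c - c')" "0 \<le> h * c" "0 \<le> h' * c'"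
      using nonneg \<open>h' \<le> h\<close> False by auto
    ultimately have "h * q + p * c - h * c + h' * t + s * c' - h' * c' \<le> n * (h + c)"
      using rows by (simp add: algebra_simps)
    also have "\<dots> \<le> n * m"
      using sums nonneg by (intro mult_left_mono) auto
    also have "\<dots> \<le> 2 * m * (n - m)"
    proof -
      have "0 \<le> m * (n - 2 * m)"
        using sums nonneg by (intro mult_nonneg_nonneg) auto
      then show ?thesis by (simp add: algebra_simps)
    qed
    finally show ?thesis .
  qed
qed

text \<open>The estimate is symmetric under exchanging the two covers, so \<open>h' <= h\<close> may
  be assumed.\<close>

lemma two_covers_bound:
  fixes n m :: int
  assumes "0 \<le> h" "0 \<le> c" "0 \<le> h'" "0 \<le> c'"
    and "h \<le> p" "c \<le> q" "h' \<le> s" "c' \<le> t"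
    and "h + c \<le> m" "h' + c' \<le> m" "p + s \<le> n" "q + t \<le> n" "2 * m \<le> n"
  shows "h * q + p * c - h * c + h' * t + s * c' - h' * c' \<le> 2 * m * (n - m)"
proof (cases "h' \<le> h")
  case True
  then show ?thesis
    using assms by (intro two_covers_bound_aux) auto
next
  case False
  then show ?thesis
    using two_covers_bound_aux[of h' c' h c s t p q m n] assms by simp
qed

section \<open>Combining both signs of the degree difference\<close>

lemma card_large_degree_differences:
  fixes R :: "'a \<Rightarrow> 'b \<Rightarrow> bool"
  assumes fin: "finite X" "finite Y" and X: "card X = m + k" and Y: "card Y = m + k"
    and "m < k"
  shows "int (card {(x, y) \<in> X \<times> Y. int k \<le> \<bar>int (card {y\<in>Y. R x y}) - int (card {x\<in>X. R x y})\<bar>})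
    \<le> 2 * int k * int m"
proof -
  define f where "f x = card {y\<in>Y. R x y}" for x
  define g where "g y = card {x\<in>X. R x y}" for y
  define B where "B = {(x, y) \<in> X \<times> Y. f x + k \<le> g y}"
  define A where "A = {(y, x) \<in> Y \<times> X. g y + k \<le> f x}"
  obtain h c where hc: "h \<le> card (fst ` B)" "c \<le> card (snd ` B)" "h + c \<le> m"
    "card B + h * c \<le> h * card (snd ` B) + card (fst ` B) * c"
    using large_degree_difference_cover[OF fin X, of R] unfolding B_def f_def g_def by blast
  \<comment> \<open>Here \<open>X\<close> and \<open>Y\<close> exchange roles: the first number
    obtained counts vertices of \<open>Y\<close>, that is, columns.\<close>
  obtain c' h' where hc': "c' \<le> card (fst ` A)" "h' \<le> card (snd ` A)" "c' + h' \<le> m"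
    "card A + c' * h' \<le> c' * card (snd ` A) + card (fst ` A) * h'"
    using large_degree_difference_cover[OF fin(2,1) Y, of "\<lambda>y x. R x y"]
    unfolding A_def f_def g_def by blast
  have f_le: "f x \<le> m + k" for x
    unfolding f_def Y[symmetric] using fin by (intro card_mono) auto
  have g_le: "g y \<le> m + k" for y
    unfolding g_def X[symmetric] using fin by (intro card_mono) auto
  have finAB: "finite A" "finite B"
    by (rule finite_subset[of _ "Y \<times> X"], use fin A_def in auto)
      (rule finite_subset[of _ "X \<times> Y"], use fin B_def in auto)
  \<comment> \<open>A pair of \<open>B\<close> satisfies \<open>f x + k <= g y <= m + k\<close>,
    hence \<open>f x <= m\<close>, whereas a pair of \<open>A\<close> has \<open>f x >= k\<close>.
    As \<open>m < k\<close>, no row serves both kinds; the same holds for columns.\<close>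
  have low_f: "f x \<le> m" if "x \<in> fst ` B" for x
    using that g_le by (force simp: B_def dest: le_trans)
  have high_f: "k \<le> f x" if "x \<in> snd ` A" for x
    using that by (auto simp: A_def)
  have high_g: "k \<le> g y" if "y \<in> snd ` B" for y
    using that by (auto simp: B_def)
  have low_g: "g y \<le> m" if "y \<in> fst ` A" for y
    using that f_le by (force simp: A_def dest: le_trans)
  have "fst ` B \<inter> snd ` A = {}"
    using low_f high_f \<open>m < k\<close> by (meson disjoint_iff leD le_less_trans)
  then have "card (fst ` B) + card (snd ` A) = card (fst ` B \<union> snd ` A)"
    using finAB by (simp add: card_Un_disjoint)
  also have "\<dots> \<le> card X"
    using fin by (intro card_mono) (auto simp: A_def B_def)
  finally have ps: "card (fst ` B) + card (snd ` A) \<le> m + k" using X by simp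
  have "snd ` B \<inter> fst ` A = {}"
    using low_g high_g \<open>m < k\<close> by (meson disjoint_iff leD le_less_trans)
  then have "card (snd ` B) + card (fst ` A) = card (snd ` B \<union> fst ` A)"
    using finAB by (simp add: card_Un_disjoint)
  also have "\<dots> \<le> card Y"
    using fin by (intro card_mono) (auto simp: A_def B_def)
  finally have qt: "card (snd ` B) + card (fst ` A) \<le> m + k" using Y by simp
  have "{(x, y) \<in> X \<times> Y. int k \<le> \<bar>int (f x) - int (g y)\<bar>} \<subseteq> B \<union> prod.swap ` A"
    by (auto simp: A_def B_def image_iff abs_if split: if_splits)
  then have "card {(x, y) \<in> X \<times> Y. int k \<le> \<bar>int (f x) - int (g y)\<bar>} \<le> card (B \<union> prod.swap ` A)"
    using finAB by (intro card_mono) auto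
  also have "\<dots> \<le> card B + card A"
    using finAB by (meson card_Un_le card_image_le add_left_mono le_trans)
  finally have "int (card {(x, y) \<in> X \<times> Y. int k \<le> \<bar>int (f x) - int (g y)\<bar>}) \<le> int (card B) + int (card A)"
    by linarith
  also have "int (card B) + int (card A) \<le>
      int h * card (snd ` B) + int (card (fst ` B)) * c - int h * c
      + int h' * card (fst ` A) + int (card (snd ` A)) * c' - int h' * c'"
  proof -
    have "int (card B + h * c) \<le> int (h * card (snd ` B) + card (fst ` B) * c)"
      "int (card A + c' * h') \<le> int (c' * card (snd ` A) + card (fst ` A) * h')"
      using hc(4) hc'(4) by (simp_all only: of_nat_le_iff)
    then show ?thesis by (simp add: mult.commute)
  qed
  also have "\<dots> \<le> 2 * int m * (int (m + k) - int m)"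
    using hc(1-3) hc'(1-3) ps qt \<open>m < k\<close> by (intro two_covers_bound) linarith+
  finally show ?thesis by (simp add: f_def g_def mult_ac)
qed

section \<open>From relations on indices to bipartite graphs\<close>

text \<open>Disjointness of \<open>U\<close> and \<open>V\<close> forces an edge at \<open>x\<close>
  to have \<open>x\<close> as its first component, and injectivity of \<open>v\<close> makes
  counting edges the same as counting indices.\<close>

lemma deg_left:
  assumes "bipartite_graph U V E" "x \<in> U" "V = v ` J" "inj_on v J"
  shows "deg E x = card {j\<in>J. (x, v j) \<in> E}"
proof -
  have "{e \<in> E. x = fst e \<or> x = snd e} = (\<lambda>j. (x, v j)) ` {j\<in>J. (x, v j) \<in> E}"
  proof (intro equalityI subsetI)
    fix e assume "e \<in> {e \<in> E. x = fst e \<or> x = snd e}"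
    moreover from this have "fst e \<in> U" "snd e \<in> V" "U \<inter> V = {}"
      using assms(1) unfolding bipartite_graph_def by auto
    ultimately have "e \<in> E" "fst e = x" "snd e \<in> v ` J"
      using assms(2,3) by blast+
    then show "e \<in> (\<lambda>j. (x, v j)) ` {j\<in>J. (x, v j) \<in> E}"
      by (cases e) auto
  qed auto
  moreover have "inj_on (\<lambda>j. (x, v j)) {j\<in>J. (x, v j) \<in> E}"
    using assms(4) by (auto simp: inj_on_def)
  ultimately show ?thesis
    by (simp add: deg_def card_image)
qed

lemma deg_right:
  assumes "bipartite_graph U V E" "y \<in> V" "U = u ` I" "inj_on u I"
  shows "deg E y = card {i\<in>I. (u i, y) \<in> E}"
proof -
  have "{e \<in> E. y = fst e \<or> y = snd e} = (\<lambda>i. (u i, y)) ` {i\<in>I. (u i, y) \<in> E}"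
  proof (intro equalityI subsetI)
    fix e assume "e \<in> {e \<in> E. y = fst e \<or> y = snd e}"
    moreover from this have "fst e \<in> U" "snd e \<in> V" "U \<inter> V = {}"
      using assms(1) unfolding bipartite_graph_def by auto
    ultimately have "e \<in> E" "snd e = y" "fst e \<in> u ` I"
      using assms(2,3) by blast+
    then show "e \<in> (\<lambda>i. (u i, y)) ` {i\<in>I. (u i, y) \<in> E}"
      by (cases e) auto
  qed auto
  moreover have "inj_on (\<lambda>i. (u i, y)) {i\<in>I. (u i, y) \<in> E}"
    using assms(4) by (auto simp: inj_on_def)
  ultimately show ?thesis
    by (simp add: deg_def card_image)
qed

theorem theorem1:
  fixes n :: nat
    and u v :: "nat \<Rightarrow> 'a"
    and U V :: "'a set"
    and E :: "('a \<times> 'a) set"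
    and k :: int
  assumes "n \<ge> 1"
    and "bipartite_graph U V E"
    and "U = u ` {1..n}" and "inj_on u {1..n}"
    and "V = v ` {1..n}" and "inj_on v {1..n}"
    and "k \<le> int n" and "real_of_int k > real n / 2"
  shows "(\<Sum>(i, j) \<in> {1..n} \<times> {1..n}.
            of_bool (\<bar>int (deg E (u i)) - int (deg E (v j))\<bar> \<ge> k) :: int)
         \<le> 2 * k * (int n - k)"
proof -
  let ?N = "{1..n}"
  define K where "K = nat k"
  define m where "m = n - K"
  have "k > 0"
    using assms(8) by (smt (verit) divide_nonneg_nonneg of_int_0_less_iff of_nat_0_le_iff)
  then have k: "k = int K" by (simp add: K_def)
  have "K \<le> n" using assms(7) k by simp
  then have n: "n = m + K" by (simp add: m_def)
  \<comment> \<open>Since \<open>n = m + K\<close>, the hypothesis that \<open>k\<close> exceeds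
    half of \<open>n\<close> says exactly this.\<close>
  have "m < K" using assms(8) n k by simp
  have degs: "deg E (u i) = card {j\<in>?N. (u i, v j) \<in> E}"
    "deg E (v i) = card {j\<in>?N. (u j, v i) \<in> E}" if "i \<in> ?N" for i
    using deg_left[OF assms(2) _ assms(5,6), of "u i"] deg_right[OF assms(2) _ assms(3,4), of "v i"]
      assms(3,5) that by auto
  have "(\<Sum>(i, j) \<in> ?N \<times> ?N. of_bool (\<bar>int (deg E (u i)) - int (deg E (v j))\<bar> \<ge> k) :: int)
      = (\<Sum>z \<in> ?N \<times> ?N. of_bool (\<bar>int (deg E (u (fst z))) - int (deg E (v (snd z)))\<bar> \<ge> k))"
    by (simp add: case_prod_beta)
  also have "\<dots> = int (card ((?N \<times> ?N) \<inter> {z. \<bar>int (deg E (u (fst z))) - int (deg E (v (snd z)))\<bar> \<ge> k}))"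
    by (subst sum_of_bool_eq) auto
  also have "(?N \<times> ?N) \<inter> {z. \<bar>int (deg E (u (fst z))) - int (deg E (v (snd z)))\<bar> \<ge> k}
      = {(i, j) \<in> ?N \<times> ?N. int K \<le> \<bar>int (card {j\<in>?N. (u i, v j) \<in> E}) - int (card {i\<in>?N. (u i, v j) \<in> E})\<bar>}"
    using degs k by auto
  also have "int (card \<dots>) \<le> 2 * int K * int m"
    using \<open>m < K\<close> n by (intro card_large_degree_differences) auto
  finally show ?thesis
    using n k by simp
qed

end
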